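(* Let $\alpha,\beta>0$. Let $R$ be a positive random variable with distribution function $H$, $H(0)=0$, with upper endpoint $\omega\in(0,\infty]$, let $B_{\alpha,\beta}$ be a beta random variable with parameters $\alpha,\beta$ independent of $R$, and let $H_{\alpha,\beta}$ be the distribution function of $R\,B_{\alpha,\beta}$. Let $k\in\mathbb{N}\cup\{0\}$ and let $\beta_0:=\beta>\beta_1>\cdots>\beta_k>\beta_{k+1}:=0$ be constants such that $\beta_{i-1}-\beta_i\in(0,1)$ for $i=1,\ldots,k+1$. Put $\delta_i:=1+\beta_i-\beta_{i-1}$. Then there exist distribution functions $H_0:=H,H_1,\ldots,H_{k+1}=H_{\alpha,\beta}$ determined iteratively by $$H_{i-1}(x)=\frac{\Gamma(\alpha+\beta_i)}{\Gamma(\alpha+\beta_{i-1})}\,x^{\alpha+\beta_{i-1}}\Bigl[(\alpha+\beta_i)\,(I_{\delta_i}\,p_{-\alpha-\beta_i-1}H_i)(x)-(\mathcal{J}_{\delta_i,\,p_{-\alpha-\beta_i}}H_i)(x)\Bigr],\qquad x\in(0,\omega),$$ for $i=1,\ldots,k+1$. Furthermore, each $H_i$, $i=1,\ldots,k+1$, possesses a density function $h_i$.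
   Context: $B_{\alpha,\beta}$ has density $\frac{\Gamma(\alpha+\beta)}{\Gamma(\alpha)\Gamma(\beta)}x^{\alpha-1}(1-x)^{\beta-1}$ on $(0,1)$, $\Gamma$ being the Euler gamma function. The lower endpoint of $H$ is assumed to be $0$. For $s\in\mathbb{R}$, $p_s(x)=x^s$, $x>0$. For $\beta>0$ the Weyl fractional-order integral operator is $$(I_\beta f)(x)=\frac{1}{\Gamma(\beta)}\int_x^\infty (y-x)^{\beta-1}f(y)\,dy,\quad x>0,$$ and, for a measurable weight function $g:(0,\infty)\to\mathbb{R}$ and a distribution function $F$, the Weyl–Stieltjes fractional-order integral operator is $$(\mathcal{J}_{\beta,g}F)(x)=\frac{1}{\Gamma(\beta)}\int_x^\infty (y-x)^{\beta-1}g(y)\,dF(y).$$ *)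

theory Defs
  imports "HOL-Probability.Probability"
begin

definition distribution_function :: "(real \<Rightarrow> real) \<Rightarrow> bool" where
  "distribution_function F \<longleftrightarrow>
     mono F \<and> (\<forall>x. continuous (at_right x) F) \<and>
     (F \<longlongrightarrow> 0) at_bot \<and> (F \<longlongrightarrow> 1) at_top"

definition lower_endpoint :: "(real \<Rightarrow> real) \<Rightarrow> ereal" where
  "lower_endpoint F = Inf (ereal ` {x. F x > 0})"

definition upper_endpoint :: "(real \<Rightarrow> real) \<Rightarrow> ereal" where
  "upper_endpoint F = Sup (ereal ` {x. F x < 1})"

definition density_of_df :: "(real \<Rightarrow> real) \<Rightarrow> (real \<Rightarrow> real) \<Rightarrow> bool" where
  "density_of_df F h \<longleftrightarrow>
     h \<in> borel_measurable borel \<and> (\<forall>x. 0 \<le> h x) \<and>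
     interval_measure F = density lborel (\<lambda>x. ennreal (h x))"

definition beta_density :: "real \<Rightarrow> real \<Rightarrow> real \<Rightarrow> real" where
  "beta_density \<alpha> \<beta> x =
     (if 0 < x \<and> x < 1
      then Gamma (\<alpha> + \<beta>) / (Gamma \<alpha> * Gamma \<beta>) * x powr (\<alpha> - 1) * (1 - x) powr (\<beta> - 1)
      else 0)"

definition pow_fun :: "real \<Rightarrow> real \<Rightarrow> real" where
  "pow_fun s x = x powr s"

text \<open>The integrals below are Lebesgue integrals, which are 0 by convention if the integrand is
  not integrable; the two predicates say that they exist.\<close>

definition weyl_exists :: "real \<Rightarrow> (real \<Rightarrow> real) \<Rightarrow> real \<Rightarrow> bool" where
  "weyl_exists \<beta> f x \<longleftrightarrow>
     set_integrable lborel {x<..} (\<lambda>y. (y - x) powr (\<beta> - 1) * f y)"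

definition weyl :: "real \<Rightarrow> (real \<Rightarrow> real) \<Rightarrow> real \<Rightarrow> real" where
  "weyl \<beta> f x = 1 / Gamma \<beta> * (LINT y:{x<..}|lborel. (y - x) powr (\<beta> - 1) * f y)"

definition weyl_stieltjes_exists ::
    "real \<Rightarrow> (real \<Rightarrow> real) \<Rightarrow> (real \<Rightarrow> real) \<Rightarrow> real \<Rightarrow> bool" where
  "weyl_stieltjes_exists \<beta> g F x \<longleftrightarrow>
     set_integrable (interval_measure F) {x<..} (\<lambda>y. (y - x) powr (\<beta> - 1) * g y)"

definition weyl_stieltjes ::
    "real \<Rightarrow> (real \<Rightarrow> real) \<Rightarrow> (real \<Rightarrow> real) \<Rightarrow> real \<Rightarrow> real" where
  "weyl_stieltjes \<beta> g F x =
     1 / Gamma \<beta> * (LINT y:{x<..}|interval_measure F. (y - x) powr (\<beta> - 1) * g y)"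

end

theory Submission
  imports Defs
begin

text \<open>Since \<open>B(a, b + c)\<close> has the law of a product of independent \<open>B(a + b, c)\<close> and \<open>B(a, b)\<close>,
  the law of \<open>R B(\<alpha>, \<beta>)\<close> is reached from that of \<open>R\<close> by multiplying successively by independent
  \<open>B(\<alpha> + \<beta>\<^sub>i, \<beta>\<^sub>i\<^sub>-\<^sub>1 - \<beta>\<^sub>i)\<close>; the law \<open>H\<^sub>i\<close> so obtained is that of \<open>R B(\<alpha> + \<beta>\<^sub>i, \<beta> - \<beta>\<^sub>i)\<close>.

  To invert a single factor \<open>B(a, b)\<close> with \<open>0 < b < 1\<close>, substitute \<open>y = x / t\<close> in the two Weyl integrals.
  The kernel becomes a multiple of the density of \<open>T = B(a + b, 1 - b)\<close>, and \<open>T B(a, b)\<close> has the law of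
  \<open>U = B(a, 1)\<close>, so that the first integral is a multiple of
  \<open>P(R U \<le> x) = P(R \<le> x) + E[(x / R) ^ a; R > x]\<close>, and the second one is the same multiple of the second summand.

  Uniqueness is a downward induction: the formula determines \<open>H\<^sub>i\<^sub>-\<^sub>1\<close> on \<open>(0, \<omega>)\<close>, and for \<open>i > 1\<close> continuity
  forces the values \<open>0\<close> and \<open>1\<close> outside.\<close>

section \<open>Beta densities and Euler's Beta integral\<close>

lemma beta_density_measurable [measurable]: "beta_density a b \<in> borel_measurable borel"
  unfolding beta_density_def[abs_def] by measurable

lemma beta_density_eq_Beta:
  "0 < x \<Longrightarrow> x < 1 \<Longrightarrow> beta_density a b x = x powr (a - 1) * (1 - x) powr (b - 1) / Beta a b"
  by (simp add: beta_density_def Beta_def)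

lemma Beta_real_pos: "0 < a \<Longrightarrow> 0 < b \<Longrightarrow> 0 < Beta a (b::real)"
  by (simp add: Beta_def Gamma_real_pos)

lemma beta_density_nonneg: "0 < a \<Longrightarrow> 0 < b \<Longrightarrow> 0 \<le> beta_density a b x"
  by (simp add: beta_density_def Gamma_real_pos less_imp_le)

text \<open>Euler's integral is available as a gauge integral over the closed interval. The
  integrand is nonnegative and two endpoints carry no mass, so it carries over to a Lebesgue
  integral over the open interval on which the density lives.\<close>

lemma nn_integral_Beta:
  assumes "0 < a" "0 < (b::real)"
  shows "(\<integral>\<^sup>+t. ennreal (t powr (a - 1) * (1 - t) powr (b - 1)) * indicator {0<..<1} t \<partial>lborel) = ennreal (Beta a b)"
  using has_integral_Beta_real[OF assms]
  by (intro nn_integral_has_integral_lebesgue') (auto simp: has_integral_Icc_iff_Ioo)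

lemma nn_integral_beta_density:
  assumes "0 < a" "0 < b"
  shows "(\<integral>\<^sup>+t. ennreal (beta_density a b t) \<partial>lborel) = 1"
proof -
  have "(\<integral>\<^sup>+t. ennreal (beta_density a b t) \<partial>lborel) =
    (\<integral>\<^sup>+t. ennreal (1 / Beta a b) * (ennreal (t powr (a - 1) * (1 - t) powr (b - 1)) * indicator {0<..<1} t) \<partial>lborel)"
  proof (rule nn_integral_cong)
    fix t show "ennreal (beta_density a b t) =
      ennreal (1 / Beta a b) * (ennreal (t powr (a - 1) * (1 - t) powr (b - 1)) * indicator {0<..<1} t)"
    proof (cases "0 < t \<and> t < 1")
      case True
      then show ?thesis
        using Beta_real_pos[OF assms]
        by (simp add: beta_density_eq_Beta ennreal_mult[symmetric])
    next
      case False
      then show ?thesis by (auto simp: beta_density_def indicator_def)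
    qed
  qed
  also have "\<dots> = ennreal (1 / Beta a b) * ennreal (Beta a b)"
    by (subst nn_integral_cmult) (simp_all add: nn_integral_Beta[OF assms])
  also have "\<dots> = 1"
    using Beta_real_pos[OF assms] by (simp add: ennreal_mult[symmetric])
  finally show ?thesis .
qed

text \<open>The affine map \<open>s + (1 - s) * v\<close> carries (0, 1) onto (s, 1). The two powers
  contribute \<open>(1 - s) powr (b + c - 2)\<close> and the Jacobian one more factor
  \<open>1 - s\<close>.\<close>

lemma nn_integral_Beta_Ioo:
  fixes b c s :: real
  assumes "0 < b" "0 < c" "s < 1"
  shows "(\<integral>\<^sup>+t. ennreal ((t - s) powr (b - 1) * (1 - t) powr (c - 1)) * indicator {s<..<1} t \<partial>lborel)
    = ennreal (Beta b c * (1 - s) powr (b + c - 1))"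
proof -
  have "(\<integral>\<^sup>+t. ennreal ((t - s) powr (b - 1) * (1 - t) powr (c - 1)) * indicator {s<..<1} t \<partial>lborel)
    = ennreal (1 - s) * (\<integral>\<^sup>+v. ennreal (((s + (1 - s) * v) - s) powr (b - 1) * (1 - (s + (1 - s) * v)) powr (c - 1))
        * indicator {s<..<1} (s + (1 - s) * v) \<partial>lborel)"
    using assms by (subst nn_integral_real_affine[where c = "1 - s" and t = s]) auto
  also have "\<dots> = ennreal (1 - s) * (\<integral>\<^sup>+v. ennreal ((1 - s) powr (b + c - 2)) *
      (ennreal (v powr (b - 1) * (1 - v) powr (c - 1)) * indicator {0<..<1} v) \<partial>lborel)"
  proof (rule arg_cong2[where f = "(*)", OF refl nn_integral_cong])
    fix v :: real
    have ind: "indicator {s<..<1} (s + (1 - s) * v) = (indicator {0<..<1} v :: ennreal)"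
    proof -
      have "s + (1 - s) * v < 1 \<longleftrightarrow> (1 - s) * v < (1 - s) * 1"
        by auto
      also have "\<dots> \<longleftrightarrow> v < 1"
        using assms(3) by (subst mult_less_cancel_left_pos) auto
      finally show ?thesis
        using assms(3) by (simp add: indicator_def zero_less_mult_iff)
    qed
    show "ennreal (((s + (1 - s) * v) - s) powr (b - 1) * (1 - (s + (1 - s) * v)) powr (c - 1))
        * indicator {s<..<1} (s + (1 - s) * v) = ennreal ((1 - s) powr (b + c - 2)) *
      (ennreal (v powr (b - 1) * (1 - v) powr (c - 1)) * indicator {0<..<1} v)"
    proof (cases "v \<in> {0<..<1}")
      case True
      have "1 - (s + (1 - s) * v) = (1 - s) * (1 - v)"
        by (simp add: algebra_simps)
      moreover have "(1 - s) powr (b + c - 2) = (1 - s) powr (b - 1) * (1 - s) powr (c - 1)"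
        by (simp add: powr_add[symmetric])
      ultimately show ?thesis
        using True assms(3) unfolding ind
        by (simp add: powr_mult ennreal_mult[symmetric] mult_ac)
    qed (simp add: ind)
  qed
  also have "\<dots> = ennreal (1 - s) * (ennreal ((1 - s) powr (b + c - 2)) * ennreal (Beta b c))"
    by (subst nn_integral_cmult) (simp_all add: nn_integral_Beta[OF assms(1,2)])
  also have "\<dots> = ennreal (Beta b c * ((1 - s) powr 1 * (1 - s) powr (b + c - 2)))"
    using assms Beta_real_pos[of b c] by (simp add: ennreal_mult[symmetric] mult_ac)
  also have "(1 - s) powr 1 * (1 - s) powr (b + c - 2) = (1 - s) powr (b + c - 1)"
    unfolding powr_add[symmetric] by (rule arg_cong) simp
  finally show ?thesis .
qed

text \<open>Density form of the product rule for independent B(a + b, c) and B(a, b):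
  \<open>beta_density a b (s / t) / t\<close> is the density at \<open>s\<close> of \<open>t\<close>
  times a B(a, b) variable. All powers of \<open>t\<close> cancel, so that a Beta integral over (s,
  1) remains.\<close>

lemma beta_density_convolution:
  assumes "0 < a" "0 < b" "0 < c"
  shows "(\<integral>\<^sup>+t. ennreal (beta_density (a + b) c t * (beta_density a b (s / t) / t)) \<partial>lborel)
    = ennreal (beta_density a (b + c) s)"
proof (cases "0 < s \<and> s < 1")
  case False
  \<comment> \<open>Both factors are nonzero only if \<open>t\<close> and \<open>s / t\<close> lie
    in (0, 1), which forces \<open>s\<close> into (0, 1).\<close>
  have "beta_density (a + b) c t * (beta_density a b (s / t) / t) = 0" for t
    using False by (auto simp: beta_density_def field_simps)
  moreover have "beta_density a (b + c) s = 0"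
    using False by (auto simp: beta_density_def)
  ultimately show ?thesis by (simp only: ennreal_0 nn_integral_0_iff_AE) simp
next
  case s: True
  \<comment> \<open>\<open>K\<close> gathers the factors that do not depend on
    \<open>t\<close>.\<close>
  define K where "K = s powr (a - 1) / (Beta (a + b) c * Beta a b)"
  have K: "0 \<le> K"
    using assms Beta_real_pos[of "a+b" c] Beta_real_pos[of a b] by (simp add: K_def)
  have "(\<integral>\<^sup>+t. ennreal (beta_density (a + b) c t * (beta_density a b (s / t) / t)) \<partial>lborel) =
    (\<integral>\<^sup>+t. ennreal K * (ennreal ((t - s) powr (b - 1) * (1 - t) powr (c - 1)) * indicator {s<..<1} t) \<partial>lborel)"
  proof (rule nn_integral_cong)
    fix t
    show "ennreal (beta_density (a + b) c t * (beta_density a b (s / t) / t)) =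
      ennreal K * (ennreal ((t - s) powr (b - 1) * (1 - t) powr (c - 1)) * indicator {s<..<1} t)"
    proof (cases "s < t \<and> t < 1")
      case t: True
      have "1 - s / t = (t - s) / t"
        using s t by (simp add: field_simps)
      then have "beta_density (a + b) c t * (beta_density a b (s / t) / t) =
        t powr (a + b - 1) * (1 - t) powr (c - 1) / Beta (a + b) c *
        ((s powr (a - 1) / t powr (a - 1)) * ((t - s) powr (b - 1) / t powr (b - 1)) / Beta a b / t)"
        using s t by (simp add: beta_density_eq_Beta powr_divide)
      also have "t powr (a + b - 1) = t powr (a - 1) * t powr (b - 1) * t powr 1"
        unfolding powr_add[symmetric] by (rule arg_cong) simp
      also have "\<dots> * (1 - t) powr (c - 1) / Beta (a + b) c *
        ((s powr (a - 1) / t powr (a - 1)) * ((t - s) powr (b - 1) / t powr (b - 1)) / Beta a b / t) =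
        K * ((t - s) powr (b - 1) * (1 - t) powr (c - 1))"
        using s t by (simp add: K_def)
      finally show ?thesis
        using t K by (simp add: ennreal_mult)
    next
      case False
      have "beta_density (a + b) c t * (beta_density a b (s / t) / t) = 0"
        using False s by (auto simp: beta_density_def field_simps)
      with False show ?thesis by auto
    qed
  qed
  also have "\<dots> = ennreal K * ennreal (Beta b c * (1 - s) powr (b + c - 1))"
    using s assms by (subst nn_integral_cmult) (simp_all add: nn_integral_Beta_Ioo)
  also have "\<dots> = ennreal (beta_density a (b + c) s)"
  proof -
    have "Gamma a \<noteq> 0" "Gamma b \<noteq> 0" "Gamma c \<noteq> 0" "Gamma (a + b) \<noteq> 0" "Gamma (b + c) \<noteq> 0" "Gamma (a + b + c) \<noteq> 0"
      using assms by (auto simp: Gamma_real_pos less_imp_neq[THEN not_sym])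
    \<comment> \<open>The constants combine through
      \<open>Beta b c / (Beta (a + b) c * Beta a b) = 1 / Beta a (b + c)\<close>.\<close>
    then have "K * (Beta b c * (1 - s) powr (b + c - 1)) = beta_density a (b + c) s"
      using s by (simp add: K_def beta_density_def Beta_def add.assoc)
    then show ?thesis
      using K by (simp add: ennreal_mult'[symmetric])
  qed
  finally show ?thesis .
qed

section \<open>The change of variables y = x / t\<close>

lemma nn_integral_inverse_substitution:
  fixes x :: real
  assumes [measurable]: "f \<in> borel_measurable borel" and x: "0 < x"
  shows "(\<integral>\<^sup>+y. f y * ennreal (x / y\<^sup>2) * indicator {x<..} y \<partial>lborel) =
    (\<integral>\<^sup>+t. f (x / t) * indicator {0<..<1} t \<partial>lborel)"
proof -
  \<comment> \<open>For \<open>t\<close> uniform on \<open>(0, 1)\<close>, \<open>x / t\<close> has the Pareto density \<open>x / y\<^sup>2\<close> on \<open>(x, \<infinity>)\<close>.\<close>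
  define P where "P = density lborel (\<lambda>y. ennreal (x / y\<^sup>2) * indicator {x<..} y)"
  define Q where "Q = distr (density lborel (\<lambda>t::real. indicator {0<..<1} t)) borel (\<lambda>t. x / t)"
  have P: "emeasure P {z<..} = ennreal (x / max x z)" for z
  proof -
    \<comment> \<open>Closing the ray at \<open>max x z\<close> adds one point of measure zero and
      gives the domain required by the fundamental theorem on a half-line.\<close>
    have "emeasure P {z<..} = (\<integral>\<^sup>+y. ennreal (x / y\<^sup>2) * indicator {max x z..} y \<partial>lborel)"
      unfolding P_def using AE_lborel_singleton[of "max x z"]
      by (subst emeasure_density) (auto intro!: nn_integral_cong_AE simp: indicator_def max_def)
    also have "\<dots> = ennreal (0 - (- x / max x z))"
    proof (rule nn_integral_FTC_atLeast)
      show "DERIV (\<lambda>y. - x / y) y :> x / y\<^sup>2" if "max x z \<le> y" for y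
        using that x by (auto intro!: derivative_eq_intros simp: power2_eq_square)
      have "((\<lambda>y. - x * inverse y) \<longlongrightarrow> - x * 0) at_top"
        by (intro tendsto_mult tendsto_const tendsto_inverse_0_at_top filterlim_ident)
      then show "((\<lambda>y. - x / y) \<longlongrightarrow> 0) at_top"
        by (simp add: field_simps)
    qed (use x in auto)
    finally show ?thesis by simp
  qed
  have Q: "emeasure Q {z<..} = ennreal (x / max x z)" for z
  proof -
    have "emeasure Q {z<..} = emeasure lborel {0<..<x / max x z}"
    proof -
      have [measurable]: "(\<lambda>t. x / t) \<in> borel_measurable borel"
        by measurable
      have ind: "indicator {0<..<1} t * indicator ((\<lambda>t. x / t) -` {z<..}) t
          = (indicator {0<..<x / max x z} t :: ennreal)" for t
      proof -
        have "t < x / max x z \<longleftrightarrow> t < 1 \<and> z < x / t" if "0 < t"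
        proof -
          have "t < x / max x z \<longleftrightarrow> t * max x z < x"
            using x by (simp add: pos_less_divide_eq)
          also have "t * max x z = max (t * x) (t * z)"
            using that by (simp add: max_mult_distrib_left)
          also have "max (t * x) (t * z) < x \<longleftrightarrow> t < 1 \<and> z < x / t"
            using that x by (simp add: pos_less_divide_eq mult.commute)
          finally show ?thesis .
        qed
        then show ?thesis
          by (auto simp: indicator_def)
      qed
      have "emeasure Q {z<..} = emeasure (density lborel (indicator {0<..<1})) ((\<lambda>t. x / t) -` {z<..})"
        unfolding Q_def by (subst emeasure_distr) auto
      also have "\<dots> = (\<integral>\<^sup>+t. indicator {0<..<1} t * indicator ((\<lambda>t. x / t) -` {z<..}) t \<partial>lborel)"
        using measurable_sets_borel[of "\<lambda>t. x / t" borel "{z<..}"]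
        by (subst emeasure_density) auto
      also have "\<dots> = (\<integral>\<^sup>+t. indicator {0<..<x / max x z} t \<partial>lborel)"
        unfolding ind ..
      finally show ?thesis by simp
    qed
    also have "\<dots> = ennreal (x / max x z)"
      using x by simp
    finally show ?thesis .
  qed
  \<comment> \<open>Borel measures on the line with the same finite values on all open upper rays
    coincide.\<close>
  have "P = Q"
    by (rule measure_eqI_lessThan) (simp_all add: P Q, simp_all add: P_def Q_def)
  then have "(\<integral>\<^sup>+y. f y \<partial>P) = (\<integral>\<^sup>+y. f y \<partial>Q)" by simp
  then show ?thesis
    unfolding P_def Q_def by (simp add: nn_integral_density nn_integral_distr mult_ac)
qed

section \<open>Multiplicative convolution of laws and beta measures\<close>

text \<open>The law of a product of independent variables with laws \<open>M\<close> and
  \<open>N\<close>. Working with laws on a product space avoids constructing the auxiliary beta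
  variables on the given probability space.\<close>

definition mult_conv :: "real measure \<Rightarrow> real measure \<Rightarrow> real measure" where
  "mult_conv M N = distr (M \<Otimes>\<^sub>M N) borel (\<lambda>(x, y). x * y)"

definition beta_measure :: "real \<Rightarrow> real \<Rightarrow> real measure" where
  "beta_measure a b = density lborel (\<lambda>x. ennreal (beta_density a b x))"

lemma sets_mult_conv [measurable_cong, simp]: "sets (mult_conv M N) = sets borel"
  by (simp add: mult_conv_def)

lemma sets_beta_measure [measurable_cong, simp]: "sets (beta_measure a b) = sets borel"
  by (simp add: beta_measure_def)

lemma real_distribution_beta_measure:
  assumes "0 < a" "0 < b"
  shows "real_distribution (beta_measure a b)"
proof -
  have "prob_space (beta_measure a b)"
    by (rule prob_spaceI) (simp add: beta_measure_def emeasure_density nn_integral_beta_density[OF assms])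
  then show ?thesis
    by (simp add: real_distribution_def real_distribution_axioms_def)
qed

lemma mult_borel_measurable_pair:
  assumes "real_distribution M" "real_distribution N"
  shows "(\<lambda>(x, y). x * y) \<in> borel_measurable (M \<Otimes>\<^sub>M N)"
proof -
  have [measurable_cong]: "sets M = sets borel" "sets N = sets borel"
    using assms by (auto simp: real_distribution_def real_distribution_axioms_def)
  show ?thesis by measurable
qed

lemma real_distribution_mult_conv:
  assumes "real_distribution M" "real_distribution N"
  shows "real_distribution (mult_conv M N)"
  unfolding mult_conv_def
  using assms mult_borel_measurable_pair[OF assms]
  by (intro prob_space.real_distribution_distr prob_space_pair) (auto simp: real_distribution_def)

lemma nn_integral_mult_conv:
  assumes M: "real_distribution M" and N: "real_distribution N"
    and f: "f \<in> borel_measurable borel"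
  shows "(\<integral>\<^sup>+z. f z \<partial>mult_conv M N) = (\<integral>\<^sup>+x. \<integral>\<^sup>+y. f (x * y) \<partial>N \<partial>M)"
proof -
  interpret N: real_distribution N by fact
  note [measurable] = f mult_borel_measurable_pair[OF M N]
  show ?thesis
    unfolding mult_conv_def
    by (subst nn_integral_distr, measurable, subst N.nn_integral_fst[symmetric])
       (simp_all add: measurable_compose[OF mult_borel_measurable_pair[OF M N] f] split_beta')
qed

text \<open>Equality of laws is tested on nonnegative functions because
  \<open>nn_integral_mult_conv\<close> then reduces identities between products to rearranging
  iterated integrals.\<close>

lemma real_distribution_eqI:
  assumes "real_distribution M" "real_distribution N"
    and "\<And>f :: real \<Rightarrow> ennreal. f \<in> borel_measurable borel \<Longrightarrow> (\<integral>\<^sup>+z. f z \<partial>M) = (\<integral>\<^sup>+z. f z \<partial>N)"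
  shows "M = N"
proof (rule measure_eqI)
  show "sets M = sets N"
    using assms(1,2) by (simp add: real_distribution_def real_distribution_axioms_def)
next
  fix A assume "A \<in> sets M"
  moreover have "sets M = sets borel" "sets N = sets borel"
    using assms(1,2) by (simp_all add: real_distribution_def real_distribution_axioms_def)
  ultimately show "emeasure M A = emeasure N A"
    using assms(3)[of "indicator A"] by simp
qed

lemma mult_conv_assoc:
  assumes M: "real_distribution M" and N: "real_distribution N" and L: "real_distribution L"
  shows "mult_conv (mult_conv M N) L = mult_conv M (mult_conv N L)"
proof (rule real_distribution_eqI)
  fix f :: "real \<Rightarrow> ennreal" assume f [measurable]: "f \<in> borel_measurable borel"
  interpret L: real_distribution L by fact
  have "(\<integral>\<^sup>+z. f z \<partial>mult_conv (mult_conv M N) L) = (\<integral>\<^sup>+x. \<integral>\<^sup>+y. \<integral>\<^sup>+z. f (x * y * z) \<partial>L \<partial>N \<partial>M)"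
    by (simp add: nn_integral_mult_conv real_distribution_mult_conv assms)
  also have "\<dots> = (\<integral>\<^sup>+z. f z \<partial>mult_conv M (mult_conv N L))"
    by (simp add: nn_integral_mult_conv real_distribution_mult_conv assms mult.assoc)
  finally show "(\<integral>\<^sup>+z. f z \<partial>mult_conv (mult_conv M N) L) = (\<integral>\<^sup>+z. f z \<partial>mult_conv M (mult_conv N L))" .
qed (intro real_distribution_mult_conv assms)+

lemma mult_conv_commute:
  assumes M: "real_distribution M" and N: "real_distribution N"
  shows "mult_conv M N = mult_conv N M"
proof (rule real_distribution_eqI)
  fix f :: "real \<Rightarrow> ennreal" assume f [measurable]: "f \<in> borel_measurable borel"
  interpret M: real_distribution M by fact
  interpret N: real_distribution N by fact
  interpret pair_sigma_finite M N ..
  show "(\<integral>\<^sup>+z. f z \<partial>mult_conv M N) = (\<integral>\<^sup>+z. f z \<partial>mult_conv N M)"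
    unfolding nn_integral_mult_conv[OF M N f] nn_integral_mult_conv[OF N M f]
    by (subst Fubini'[symmetric]) (simp_all add: mult.commute)
qed (intro real_distribution_mult_conv assms)+

lemma AE_beta_measure: "AE u in beta_measure a b. 0 < u \<and> u < 1"
  unfolding beta_measure_def by (subst AE_density) (auto simp: beta_density_def)

text \<open>The exceptional set has measure equal to the iterated integral of its indicator, whose
  inner integral vanishes for almost every \<open>x\<close>.\<close>

lemma AE_mult_conv:
  assumes M: "real_distribution M" and N: "real_distribution N"
    and P [measurable]: "Measurable.pred borel P" and AE: "AE x in M. AE y in N. P (x * y)"
  shows "AE z in mult_conv M N. P z"
proof -
  have [measurable_cong]: "sets M = sets borel" "sets N = sets borel"
    using M N by (simp_all add: real_distribution_def real_distribution_axioms_def)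
  have "(\<integral>\<^sup>+z. indicator {z. \<not> P z} z \<partial>mult_conv M N) = (\<integral>\<^sup>+x. \<integral>\<^sup>+y. indicator {z. \<not> P z} (x * y) \<partial>N \<partial>M)"
    by (intro nn_integral_mult_conv M N) measurable
  also have "\<dots> = (\<integral>\<^sup>+x. 0 \<partial>M)"
  proof (rule nn_integral_cong_AE)
    show "AE x in M. (\<integral>\<^sup>+y. indicator {z. \<not> P z} (x * y) \<partial>N) = (0::ennreal)"
      using AE
    proof eventually_elim
      case (elim x)
      then have "(\<integral>\<^sup>+y. indicator {z. \<not> P z} (x * y) \<partial>N) = (\<integral>\<^sup>+y. 0 \<partial>N)"
        by (intro nn_integral_cong_AE) (auto elim!: eventually_mono)
      then show ?case by simp
    qed
  qed
  finally have "emeasure (mult_conv M N) {z. \<not> P z} = 0"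
    by simp
  then show ?thesis
    by (intro AE_I[of _ _ "{z. \<not> P z}"]) (auto simp: measurable)
qed

text \<open>For fixed \<open>r > 0\<close>, \<open>r\<close> times a beta variable has density
  \<open>beta_density a b (y / r) / r\<close>. Mixing over \<open>r\<close> and exchanging the
  integrals gives a density whatever the nature of \<open>M\<close>, atoms included.\<close>

lemma mult_conv_beta_eq_density:
  assumes M: "real_distribution M" and pos: "AE r in M. 0 < r" and ab: "0 < a" "0 < b"
  shows "mult_conv M (beta_measure a b) =
    density lborel (\<lambda>y. \<integral>\<^sup>+r. ennreal (beta_density a b (y / r) / r) \<partial>M)"
proof (rule measure_eqI)
  fix A assume "A \<in> sets (mult_conv M (beta_measure a b))"
  then have A [measurable]: "A \<in> sets borel" by simp
  interpret M: real_distribution M by fact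
  interpret pair_sigma_finite M lborel ..
  note beta = real_distribution_beta_measure[OF ab]
  have "emeasure (mult_conv M (beta_measure a b)) A = (\<integral>\<^sup>+z. indicator A z \<partial>mult_conv M (beta_measure a b))"
    by simp
  also have "\<dots> = (\<integral>\<^sup>+r. \<integral>\<^sup>+u. indicator A (r * u) \<partial>beta_measure a b \<partial>M)"
    by (rule nn_integral_mult_conv[OF M beta]) simp
  also have "\<dots> = (\<integral>\<^sup>+r. \<integral>\<^sup>+y. ennreal (beta_density a b (y / r) / r) * indicator A y \<partial>lborel \<partial>M)"
  proof (rule nn_integral_cong_AE)
    show "AE r in M. (\<integral>\<^sup>+u. indicator A (r * u) \<partial>beta_measure a b) =
      (\<integral>\<^sup>+y. ennreal (beta_density a b (y / r) / r) * indicator A y \<partial>lborel)"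
      using pos
    proof eventually_elim
      case (elim r)
      have "(\<integral>\<^sup>+u. indicator A (r * u) \<partial>beta_measure a b) =
        (\<integral>\<^sup>+u. ennreal (beta_density a b u) * indicator A (r * u) \<partial>lborel)"
        unfolding beta_measure_def by (subst nn_integral_density) auto
      \<comment> \<open>A factor \<open>r\<close> is split off to serve as the Jacobian of
        \<open>y = r * u\<close>.\<close>
      also have "\<dots> = (\<integral>\<^sup>+u. ennreal r * (ennreal (beta_density a b (r * u / r) / r) * indicator A (r * u)) \<partial>lborel)"
        using elim beta_density_nonneg[OF ab]
        by (intro nn_integral_cong) (simp add: mult.assoc[symmetric] ennreal_mult[symmetric])
      also have "\<dots> = ennreal r * (\<integral>\<^sup>+u. ennreal (beta_density a b (r * u / r) / r) * indicator A (r * u) \<partial>lborel)"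
        by (subst nn_integral_cmult) auto
      also have "\<dots> = (\<integral>\<^sup>+y. ennreal (beta_density a b (y / r) / r) * indicator A y \<partial>lborel)"
        using elim by (subst (2) nn_integral_real_affine[where c = r and t = 0]) auto
      finally show ?case .
    qed
  qed
  also have "\<dots> = (\<integral>\<^sup>+y. \<integral>\<^sup>+r. ennreal (beta_density a b (y / r) / r) * indicator A y \<partial>M \<partial>lborel)"
    by (rule Fubini'[symmetric]) measurable
  also have "\<dots> = (\<integral>\<^sup>+y. (\<integral>\<^sup>+r. ennreal (beta_density a b (y / r) / r) \<partial>M) * indicator A y \<partial>lborel)"
    by (intro nn_integral_cong nn_integral_multc) measurable
  also have "\<dots> = emeasure (density lborel (\<lambda>y. \<integral>\<^sup>+r. ennreal (beta_density a b (y / r) / r) \<partial>M)) A"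
    by (subst emeasure_density) auto
  finally show "emeasure (mult_conv M (beta_measure a b)) A =
    emeasure (density lborel (\<lambda>y. \<integral>\<^sup>+r. ennreal (beta_density a b (y / r) / r) \<partial>M)) A" .
qed simp

text \<open>With B(a + b, c) as the mixing law, the density of
  \<open>mult_conv_beta_eq_density\<close> is the integral evaluated in
  \<open>beta_density_convolution\<close>.\<close>

lemma mult_conv_beta_beta:
  assumes "0 < a" "0 < b" "0 < c"
  shows "mult_conv (beta_measure (a + b) c) (beta_measure a b) = beta_measure a (b + c)"
proof -
  have [simp]: "0 < a + b" using assms by simp
  have "(\<integral>\<^sup>+r. ennreal (beta_density a b (y / r) / r) \<partial>beta_measure (a + b) c) = ennreal (beta_density a (b + c) y)" for y
  proof -
    have "(\<integral>\<^sup>+r. ennreal (beta_density a b (y / r) / r) \<partial>beta_measure (a + b) c) =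
      (\<integral>\<^sup>+r. ennreal (beta_density (a + b) c r * (beta_density a b (y / r) / r)) \<partial>lborel)"
      unfolding beta_measure_def using assms
      by (subst nn_integral_density)
         (auto intro!: nn_integral_cong ennreal_mult'[symmetric] beta_density_nonneg simp del: times_divide_eq_right)
    then show ?thesis
      using beta_density_convolution[OF assms] by simp
  qed
  moreover have "AE r in beta_measure (a + b) c. 0 < r"
    using AE_beta_measure by (rule eventually_mono) simp
  ultimately show ?thesis
    using assms by (subst mult_conv_beta_eq_density) (simp_all add: real_distribution_beta_measure, simp add: beta_measure_def)
qed

text \<open>The mixture density takes extended values. Its integral is 1, so it is finite almost
  everywhere and \<open>enn2real\<close> alters it only on a null set.\<close>

lemma mult_conv_beta_has_density:
  assumes M: "real_distribution M" and pos: "AE r in M. 0 < r" and ab: "0 < a" "0 < b"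
  shows "\<exists>h. h \<in> borel_measurable borel \<and> (\<forall>x. 0 \<le> h x) \<and>
    mult_conv M (beta_measure a b) = density lborel (\<lambda>x. ennreal (h x))"
proof -
  interpret M: real_distribution M by fact
  interpret C: real_distribution "mult_conv M (beta_measure a b)"
    by (intro real_distribution_mult_conv M real_distribution_beta_measure ab)
  define g where "g y = (\<integral>\<^sup>+r. ennreal (beta_density a b (y / r) / r) \<partial>M)" for y
  have g [measurable]: "g \<in> borel_measurable borel"
    unfolding g_def by measurable
  have eq: "mult_conv M (beta_measure a b) = density lborel g"
    unfolding g_def by (rule mult_conv_beta_eq_density[OF assms])
  have "(\<integral>\<^sup>+y. g y \<partial>lborel) = emeasure (mult_conv M (beta_measure a b)) (space (mult_conv M (beta_measure a b)))"
    unfolding eq by (simp add: emeasure_density)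
  then have "(\<integral>\<^sup>+y. g y \<partial>lborel) = 1"
    using C.emeasure_space_1 by simp
  then have "AE y in lborel. g y \<noteq> \<infinity>"
    by (intro nn_integral_PInf_AE) auto
  then have "density lborel g = density lborel (\<lambda>y. ennreal (enn2real (g y)))"
    by (intro density_cong) (auto elim!: eventually_mono simp: less_top)
  then show ?thesis
    by (intro exI[of _ "\<lambda>y. enn2real (g y)"]) (auto simp: eq)
qed

section \<open>The two Weyl integrals of a product with a beta factor\<close>

text \<open>The substitution y = x / t, with a free function \<phi> so that it serves both
  integrals: \<phi> is a distribution function in the first and \<open>y\<close> times a density in
  the second.\<close>

lemma nn_integral_weyl_kernel:
  fixes a b x :: real
  assumes ab: "0 < a" "0 < b" "b < 1" and x: "0 < x" and \<phi> [measurable]: "\<phi> \<in> borel_measurable borel"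
  shows "(\<integral>\<^sup>+y. ennreal ((y - x) powr - b * y powr (- a - 1)) * \<phi> y * indicator {x<..} y \<partial>lborel) =
    ennreal (x powr (- a - b) * Beta (a + b) (1 - b)) *
      (\<integral>\<^sup>+t. ennreal (beta_density (a + b) (1 - b) t) * \<phi> (x / t) \<partial>lborel)"
proof -
  define K where "K = x powr (- a - b) * Beta (a + b) (1 - b)"
  have B: "0 < Beta (a + b) (1 - b)"
    using ab by (intro Beta_real_pos) auto
  then have K: "0 \<le> K" by (simp add: K_def)
  \<comment> \<open>The Jacobian \<open>x / y\<^sup>2\<close> is split off to match
    \<open>nn_integral_inverse_substitution\<close>.\<close>
  have "(\<integral>\<^sup>+y. ennreal ((y - x) powr - b * y powr (- a - 1)) * \<phi> y * indicator {x<..} y \<partial>lborel) =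
    (\<integral>\<^sup>+y. (ennreal ((y - x) powr - b * y powr (1 - a) / x) * \<phi> y) * ennreal (x / y\<^sup>2) * indicator {x<..} y \<partial>lborel)"
  proof (rule nn_integral_cong)
    fix y
    show "ennreal ((y - x) powr - b * y powr (- a - 1)) * \<phi> y * indicator {x<..} y =
      (ennreal ((y - x) powr - b * y powr (1 - a) / x) * \<phi> y) * ennreal (x / y\<^sup>2) * indicator {x<..} y"
    proof (cases "x < y")
      case True
      have "y powr (- a - 1) * y powr 2 = y powr (1 - a)"
        unfolding powr_add[symmetric] by (rule arg_cong) simp
      then have "(y - x) powr - b * y powr (- a - 1) = ((y - x) powr - b * y powr (1 - a) / x) * (x / y\<^sup>2)"
        using True x by (simp add: field_simps powr_numeral)
      then have "ennreal ((y - x) powr - b * y powr (- a - 1)) =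
          ennreal ((y - x) powr - b * y powr (1 - a) / x) * ennreal (x / y\<^sup>2)"
        using x by (simp only:) (intro ennreal_mult, auto)
      then show ?thesis
        by (simp add: mult_ac)
    qed simp
  qed
  also have "\<dots> = (\<integral>\<^sup>+t. (ennreal ((x / t - x) powr - b * (x / t) powr (1 - a) / x) * \<phi> (x / t)) * indicator {0<..<1} t \<partial>lborel)"
    by (rule nn_integral_inverse_substitution) (use x in measurable)
  also have "\<dots> = (\<integral>\<^sup>+t. ennreal K * (ennreal (beta_density (a + b) (1 - b) t) * \<phi> (x / t)) \<partial>lborel)"
  proof (rule nn_integral_cong)
    fix t
    show "(ennreal ((x / t - x) powr - b * (x / t) powr (1 - a) / x) * \<phi> (x / t)) * indicator {0<..<1} t =
      ennreal K * (ennreal (beta_density (a + b) (1 - b) t) * \<phi> (x / t))"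
    proof (cases "0 < t \<and> t < 1")
      case True
      have "x / t - x = x * (1 - t) / t"
        using True by (simp add: field_simps)
      then have "(x / t - x) powr - b * (x / t) powr (1 - a) / x =
        (x powr - b * x powr (1 - a) * x powr - 1) * (1 - t) powr - b / (t powr - b * t powr (1 - a))"
        using True x by (simp add: powr_divide powr_mult powr_minus_divide mult_ac)
      \<comment> \<open>The exponents of \<open>x\<close> add up to - a - b. Those of
        \<open>t\<close> add up to 1 - a - b, and the reciprocal of this power together with
        \<open>(1 - t) powr - b\<close> is the unnormalised density of B(a + b, 1 - b).\<close>
      also have "x powr - b * x powr (1 - a) * x powr - 1 = x powr (- a - b)"
        unfolding powr_add[symmetric] by (rule arg_cong) simp
      also have "t powr - b * t powr (1 - a) = inverse (t powr (a + b - 1))"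
        unfolding powr_minus[symmetric] powr_add[symmetric] by (rule arg_cong) simp
      also have "x powr (- a - b) * (1 - t) powr - b / inverse (t powr (a + b - 1)) = K * beta_density (a + b) (1 - b) t"
        using True B by (simp add: K_def beta_density_eq_Beta field_simps)
      finally show ?thesis
        using True K by (simp add: ennreal_mult' mult_ac)
    qed (auto simp: beta_density_def)
  qed
  also have "\<dots> = ennreal K * (\<integral>\<^sup>+t. ennreal (beta_density (a + b) (1 - b) t) * \<phi> (x / t) \<partial>lborel)"
    by (rule nn_integral_cmult) measurable
  finally show ?thesis
    unfolding K_def .
qed

lemma beta_density_1:
  assumes "0 < a"
  shows "beta_density a 1 s = (if 0 < s \<and> s < 1 then a * s powr (a - 1) else 0)"
proof -
  have "Gamma a \<noteq> 0"
    using assms Gamma_real_pos[of a] by linarith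
  moreover have "Gamma (a + 1) = a * Gamma a"
    using assms by (auto intro!: Gamma_plus1)
  ultimately show ?thesis
    by (simp add: beta_density_def)
qed

lemma emeasure_beta_measure_1:
  assumes a: "0 < a" and z: "0 < z"
  shows "emeasure (beta_measure a 1) {..z} = ennreal (min 1 z powr a)"
proof -
  have "emeasure (beta_measure a 1) {..z} =
      (\<integral>\<^sup>+s. ennreal (beta_density a 1 s) * indicator {..z} s \<partial>lborel)"
    unfolding beta_measure_def by (subst emeasure_density) auto
  \<comment> \<open>At 1 the beta density is 0 by definition while the power is not; the endpoints
    are discarded as null sets.\<close>
  also have "\<dots> = (\<integral>\<^sup>+s. ennreal (a * s powr (a - 1)) * indicator {0..min 1 z} s \<partial>lborel)"
    using AE_lborel_singleton[of "1::real"] AE_lborel_singleton[of "0::real"]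
    by (intro nn_integral_cong_AE, eventually_elim) (auto simp: beta_density_1[OF a] indicator_def)
  also have "\<dots> = ennreal (a * (min 1 z powr a / a))"
    using a z has_integral_powr_from_0[of "a - 1" "min 1 z"]
    by (intro nn_integral_has_integral_lebesgue' has_integral_mult_right) auto
  finally show ?thesis using a by simp
qed

text \<open>Let \<open>U\<close> have law B(a, 1). Given \<open>r \<le> x\<close>, the event
  \<open>r * U \<le> x\<close> is almost sure; given \<open>r > x\<close>, it has probability
  \<open>(x / r) powr a\<close>.\<close>

lemma emeasure_mult_conv_beta_1:
  assumes M: "real_distribution M" and pos: "AE r in M. 0 < r" and a: "0 < a" and x: "0 < x"
  shows "emeasure (mult_conv M (beta_measure a 1)) {..x} =
    emeasure M {..x} + (\<integral>\<^sup>+r. ennreal ((x / r) powr a) * indicator {x<..} r \<partial>M)"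
proof -
  interpret M: real_distribution M by fact
  note beta = real_distribution_beta_measure[OF a zero_less_one]
  have "emeasure (mult_conv M (beta_measure a 1)) {..x} =
      (\<integral>\<^sup>+z. indicator {..x} z \<partial>mult_conv M (beta_measure a 1))"
    by simp
  also have "\<dots> = (\<integral>\<^sup>+r. \<integral>\<^sup>+u. indicator {..x} (r * u) \<partial>beta_measure a 1 \<partial>M)"
    by (rule nn_integral_mult_conv[OF M beta]) simp
  also have "\<dots> = (\<integral>\<^sup>+r. indicator {..x} r + ennreal ((x / r) powr a) * indicator {x<..} r \<partial>M)"
  proof (rule nn_integral_cong_AE)
    show "AE r in M. (\<integral>\<^sup>+u. indicator {..x} (r * u) \<partial>beta_measure a 1) =
        indicator {..x} r + ennreal ((x / r) powr a) * indicator {x<..} r"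
      using pos
    proof eventually_elim
      case (elim r)
      have "(\<integral>\<^sup>+u. indicator {..x} (r * u) \<partial>beta_measure a 1) = (\<integral>\<^sup>+u. indicator {..x / r} u \<partial>beta_measure a 1)"
        using elim by (intro nn_integral_cong) (auto simp: indicator_def field_simps)
      also have "\<dots> = ennreal (min 1 (x / r) powr a)"
        using elim x a emeasure_beta_measure_1[of a "x / r"] by simp
      finally show ?case
        using elim x by (auto simp: min_def indicator_def)
    qed
  qed
  also have "\<dots> = emeasure M {..x} + (\<integral>\<^sup>+r. ennreal ((x / r) powr a) * indicator {x<..} r \<partial>M)"
    by (subst nn_integral_add) auto
  finally show ?thesis .
qed

text \<open>After the substitution the integral is a multiple of the probability that
  \<open>T * S \<le> x\<close>, with \<open>T\<close> distributed as B(a + b, 1 - b) and independent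
  of \<open>S\<close>, whose law is the product law.\<close>

lemma weyl_integral_beta:
  assumes M: "real_distribution M" and pos: "AE r in M. 0 < r"
    and ab: "0 < a" "0 < b" "b < 1" and x: "0 < x"
  shows "(\<integral>\<^sup>+y. ennreal ((y - x) powr - b * y powr (- a - 1)) *
        emeasure (mult_conv M (beta_measure a b)) {..y} * indicator {x<..} y \<partial>lborel) =
    ennreal (x powr (- a - b) * Beta (a + b) (1 - b)) *
      (emeasure M {..x} + (\<integral>\<^sup>+r. ennreal ((x / r) powr a) * indicator {x<..} r \<partial>M))"
proof -
  let ?G = "mult_conv M (beta_measure a b)" and ?T = "beta_measure (a + b) (1 - b)"
  have G: "real_distribution ?G" and B: "real_distribution (beta_measure a b)" and T: "real_distribution ?T"
    using ab by (auto intro!: real_distribution_mult_conv real_distribution_beta_measure M)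
  interpret G: real_distribution ?G by fact
  have "cdf ?G \<in> borel_measurable borel"
    by (intro borel_measurable_mono monoI G.cdf_nondecreasing)
  then have [measurable]: "(\<lambda>y. emeasure ?G {..y}) \<in> borel_measurable borel"
    unfolding G.emeasure_eq_measure cdf_def by measurable
  have "(\<integral>\<^sup>+t. ennreal (beta_density (a + b) (1 - b) t) * emeasure ?G {..x / t} \<partial>lborel) =
    (\<integral>\<^sup>+t. emeasure ?G {..x / t} \<partial>?T)"
    unfolding beta_measure_def[of "a + b"] by (subst nn_integral_density) auto
  also have "\<dots> = (\<integral>\<^sup>+t. \<integral>\<^sup>+s. indicator {..x} (t * s) \<partial>?G \<partial>?T)"
  proof (rule nn_integral_cong_AE)
    show "AE t in ?T. emeasure ?G {..x / t} = (\<integral>\<^sup>+s. indicator {..x} (t * s) \<partial>?G)"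
      using AE_beta_measure
    proof eventually_elim
      case (elim t)
      then have "(\<integral>\<^sup>+s. indicator {..x} (t * s) \<partial>?G) = (\<integral>\<^sup>+s. indicator {..x / t} s \<partial>?G)"
        by (intro nn_integral_cong) (auto simp: indicator_def field_simps)
      then show ?case by simp
    qed
  qed
  also have "\<dots> = (\<integral>\<^sup>+z. indicator {..x} z \<partial>mult_conv ?T ?G)"
    by (rule nn_integral_mult_conv[symmetric, OF T G]) simp
  \<comment> \<open>Regrouping puts \<open>T\<close> next to the beta factor, where the parameters b
    and 1 - b add up to 1.\<close>
  also have "mult_conv ?T ?G = mult_conv M (mult_conv ?T (beta_measure a b))"
    using mult_conv_commute[OF T G] mult_conv_assoc[OF M B T] mult_conv_commute[OF T B] by simp
  also have "mult_conv ?T (beta_measure a b) = beta_measure a 1"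
    using mult_conv_beta_beta[of a b "1 - b"] ab by simp
  finally have "(\<integral>\<^sup>+t. ennreal (beta_density (a + b) (1 - b) t) * emeasure ?G {..x / t} \<partial>lborel) =
      emeasure M {..x} + (\<integral>\<^sup>+r. ennreal ((x / r) powr a) * indicator {x<..} r \<partial>M)"
    using emeasure_mult_conv_beta_1[OF M pos ab(1) x] by simp
  then show ?thesis
    by (subst nn_integral_weyl_kernel[OF ab x]) simp_all
qed

text \<open>Against the density \<open>g\<close> of the product law, the kernel lemma applies with
  \<phi> equal to \<open>y * g y\<close>. Exchanging the integrals and applying
  \<open>beta_density_convolution\<close> at \<open>x / r\<close> leaves \<open>x / r\<close> times
  the B(a, 1) density there.\<close>

lemma weyl_stieltjes_integral_beta:
  assumes M: "real_distribution M" and pos: "AE r in M. 0 < r"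
    and ab: "0 < a" "0 < b" "b < 1" and x: "0 < x"
  shows "(\<integral>\<^sup>+y. ennreal ((y - x) powr - b * y powr - a) * indicator {x<..} y \<partial>mult_conv M (beta_measure a b)) =
    ennreal (x powr (- a - b) * Beta (a + b) (1 - b)) *
      (ennreal a * (\<integral>\<^sup>+r. ennreal ((x / r) powr a) * indicator {x<..} r \<partial>M))"
proof -
  interpret M: real_distribution M by fact
  interpret pair_sigma_finite M lborel ..
  note nonneg = beta_density_nonneg[OF ab(1,2)]
  define g where "g y = (\<integral>\<^sup>+r. ennreal (beta_density a b (y / r) / r) \<partial>M)" for y
  have g [measurable]: "g \<in> borel_measurable borel"
    unfolding g_def by measurable
  have "mult_conv M (beta_measure a b) = density lborel g"
    unfolding g_def by (rule mult_conv_beta_eq_density[OF M pos ab(1,2)])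
  then have "(\<integral>\<^sup>+y. ennreal ((y - x) powr - b * y powr - a) * indicator {x<..} y \<partial>mult_conv M (beta_measure a b)) =
    (\<integral>\<^sup>+y. g y * (ennreal ((y - x) powr - b * y powr - a) * indicator {x<..} y) \<partial>lborel)"
    by (simp add: nn_integral_density)
  also have "\<dots> = (\<integral>\<^sup>+y. ennreal ((y - x) powr - b * y powr (- a - 1)) * (ennreal y * g y) * indicator {x<..} y \<partial>lborel)"
  proof (rule nn_integral_cong)
    fix y
    show "g y * (ennreal ((y - x) powr - b * y powr - a) * indicator {x<..} y) =
      ennreal ((y - x) powr - b * y powr (- a - 1)) * (ennreal y * g y) * indicator {x<..} y"
    proof (cases "x < y")
      case True
      have "y powr - a = y powr (- a - 1) * y"
        using True x by (simp add: powr_diff)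
      then show ?thesis
        using True x by (simp add: ennreal_mult mult_ac)
    qed simp
  qed
  also have "\<dots> = ennreal (x powr (- a - b) * Beta (a + b) (1 - b)) *
      (\<integral>\<^sup>+t. ennreal (beta_density (a + b) (1 - b) t) * (ennreal (x / t) * g (x / t)) \<partial>lborel)"
    by (rule nn_integral_weyl_kernel[OF ab x]) measurable
  also have "(\<integral>\<^sup>+t. ennreal (beta_density (a + b) (1 - b) t) * (ennreal (x / t) * g (x / t)) \<partial>lborel) =
    (\<integral>\<^sup>+t. \<integral>\<^sup>+r. ennreal (beta_density (a + b) (1 - b) t * (x / t)) * ennreal (beta_density a b (x / t / r) / r) \<partial>M \<partial>lborel)"
  proof (rule nn_integral_cong)
    fix t
    have "ennreal (beta_density (a + b) (1 - b) t) * ennreal (x / t) = ennreal (beta_density (a + b) (1 - b) t * (x / t))"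
      using beta_density_nonneg[of "a + b" "1 - b"] ab by (intro ennreal_mult'[symmetric]) auto
    then show "ennreal (beta_density (a + b) (1 - b) t) * (ennreal (x / t) * g (x / t)) =
      (\<integral>\<^sup>+r. ennreal (beta_density (a + b) (1 - b) t * (x / t)) * ennreal (beta_density a b (x / t / r) / r) \<partial>M)"
      unfolding g_def by (subst nn_integral_cmult) (auto simp: mult.assoc[symmetric])
  qed
  also have "\<dots> = (\<integral>\<^sup>+r. \<integral>\<^sup>+t. ennreal (beta_density (a + b) (1 - b) t * (x / t)) * ennreal (beta_density a b (x / t / r) / r) \<partial>lborel \<partial>M)"
    by (rule Fubini') measurable
  also have "\<dots> = (\<integral>\<^sup>+r. ennreal a * (ennreal ((x / r) powr a) * indicator {x<..} r) \<partial>M)"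
  proof (rule nn_integral_cong_AE)
    show "AE r in M. (\<integral>\<^sup>+t. ennreal (beta_density (a + b) (1 - b) t * (x / t)) * ennreal (beta_density a b (x / t / r) / r) \<partial>lborel)
      = ennreal a * (ennreal ((x / r) powr a) * indicator {x<..} r)"
      using pos
    proof eventually_elim
      case (elim r)
      have "(\<integral>\<^sup>+t. ennreal (beta_density (a + b) (1 - b) t * (x / t)) * ennreal (beta_density a b (x / t / r) / r) \<partial>lborel) =
        (\<integral>\<^sup>+t. ennreal (x / r) * ennreal (beta_density (a + b) (1 - b) t * (beta_density a b ((x / r) / t) / t)) \<partial>lborel)"
      proof (rule nn_integral_cong)
        fix t
        have "ennreal (beta_density (a + b) (1 - b) t * (x / t)) * ennreal (beta_density a b (x / t / r) / r) =
          ennreal (beta_density (a + b) (1 - b) t * (x / t) * (beta_density a b (x / t / r) / r))"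
          using elim nonneg by (intro ennreal_mult''[symmetric]) auto
        also have "beta_density (a + b) (1 - b) t * (x / t) * (beta_density a b (x / t / r) / r) =
          x / r * (beta_density (a + b) (1 - b) t * (beta_density a b ((x / r) / t) / t))"
          by (simp add: mult_ac)
        also have "ennreal \<dots> = ennreal (x / r) * ennreal (beta_density (a + b) (1 - b) t * (beta_density a b ((x / r) / t) / t))"
          using elim x by (intro ennreal_mult') auto
        finally show "ennreal (beta_density (a + b) (1 - b) t * (x / t)) * ennreal (beta_density a b (x / t / r) / r) =
          ennreal (x / r) * ennreal (beta_density (a + b) (1 - b) t * (beta_density a b ((x / r) / t) / t))" .
      qed
      also have "\<dots> = ennreal (x / r) * ennreal (beta_density a 1 (x / r))"
        using beta_density_convolution[of a b "1 - b" "x / r"] ab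
        by (subst nn_integral_cmult) auto
      also have "\<dots> = ennreal (x / r * beta_density a 1 (x / r))"
        using elim x by (intro ennreal_mult'[symmetric]) auto
      \<comment> \<open>Both sides vanish for \<open>r \<le> x\<close>, also at
        \<open>r = x\<close>, since the density is 0 at 1.\<close>
      also have "x / r * beta_density a 1 (x / r) = a * ((x / r) powr a * indicator {x<..} r)"
        using elim x by (auto simp: beta_density_1[OF ab(1)] powr_diff indicator_def)
      also have "ennreal \<dots> = ennreal a * (ennreal ((x / r) powr a) * indicator {x<..} r)"
        using ab by (auto simp: ennreal_mult indicator_def)
      finally show ?case .
    qed
  qed
  also have "\<dots> = ennreal a * (\<integral>\<^sup>+r. ennreal ((x / r) powr a) * indicator {x<..} r \<partial>M)"
    by (rule nn_integral_cmult) measurable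
  finally show ?thesis .
qed

section \<open>Distribution functions, endpoints and equality\<close>

lemma (in real_distribution) distribution_function_cdf: "distribution_function (cdf M)"
  unfolding distribution_function_def
  using cdf_nondecreasing cdf_is_right_cont cdf_lim_at_bot cdf_lim_at_top_prob
  by (auto simp: mono_def)

text \<open>Identifies the Stieltjes measure in \<open>weyl_stieltjes\<close> and
  \<open>density_of_df\<close> with the underlying law.\<close>

lemma (in real_distribution) interval_measure_cdf: "interval_measure (cdf M) = M"
  by (intro cdf_unique real_distribution_interval_measure real_distribution_axioms cdf_interval_measure
      cdf_nondecreasing cdf_is_right_cont cdf_lim_at_bot cdf_lim_at_top_prob)

lemma distribution_function_nonneg: "distribution_function F \<Longrightarrow> 0 \<le> F x"
  unfolding distribution_function_def
  by (rule tendsto_upperbound[of F _ at_bot])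
     (auto intro!: eventually_mono[OF eventually_le_at_bot[of x]] simp: mono_def)

lemma distribution_function_le_1: "distribution_function F \<Longrightarrow> F x \<le> 1"
  unfolding distribution_function_def
  by (rule tendsto_lowerbound[of F _ at_top])
     (auto intro!: eventually_mono[OF eventually_ge_at_top[of x]] simp: mono_def)

text \<open>Strictly above the endpoint this is the definition of the supremum; right-continuity
  then gives the value at the endpoint itself.\<close>

lemma distribution_function_eq_1:
  assumes F: "distribution_function F" and x: "upper_endpoint F \<le> ereal x"
  shows "F x = 1"
proof (rule antisym)
  have "1 \<le> F y" if "x < y" for y
  proof (rule ccontr)
    assume "\<not> 1 \<le> F y"
    then have "ereal y \<le> upper_endpoint F"
      unfolding upper_endpoint_def by (intro Sup_upper) auto
    with x that show False
      by (meson ereal_less_eq(3) leD order_trans)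
  qed
  moreover have "(F \<longlongrightarrow> F x) (at_right x)"
    using F by (simp add: distribution_function_def continuous_within)
  ultimately show "1 \<le> F x"
    by (intro tendsto_lowerbound[of F "F x" "at_right x"]) (auto simp: eventually_at_filter)
qed (rule distribution_function_le_1[OF F])

text \<open>Monotonicity squeezes \<open>F\<close> outside the interval. For
  \<open>x \<le> 0\<close>, \<open>F x\<close> lies below \<open>G z\<close> for small
  \<open>z > 0\<close>, and these values tend to 0. From \<omega> on, it lies above
  \<open>G z\<close> for \<open>z\<close> increasing to \<omega>, and these values tend to 1.
  Continuity is assumed of \<open>G\<close> only.\<close>

lemma distribution_function_eqI:
  fixes \<omega> :: ereal
  assumes F: "distribution_function F" and G: "distribution_function G"
    and cont: "\<And>x. isCont G x" and G0: "G 0 = 0" and G1: "\<And>x. \<omega> \<le> ereal x \<Longrightarrow> G x = 1"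
    and \<omega>: "0 < \<omega>" and eq: "\<And>x. 0 < x \<Longrightarrow> ereal x < \<omega> \<Longrightarrow> F x = G x"
  shows "F = G"
proof
  fix x
  have mono: "u \<le> v \<Longrightarrow> F u \<le> F v" "u \<le> v \<Longrightarrow> G u \<le> G v" for u v
    using F G by (auto simp: distribution_function_def mono_def)
  consider "x \<le> 0" | "0 < x" "ereal x < \<omega>" | "0 < x" "\<omega> \<le> ereal x"
    by fastforce
  then show "F x = G x"
  proof cases
    case 1
    obtain y where y: "0 < y" "ereal y < \<omega>"
      using ereal_dense2[OF \<omega>] by (auto simp: zero_ereal_def)
    have "(G \<longlongrightarrow> 0) (at_right 0)"
      using cont[of 0] G0 by (simp add: isCont_def filterlim_at_split)
    moreover have "\<forall>\<^sub>F z in at_right 0. F x \<le> G z"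
      using eventually_at_right_less[of 0] eventually_at_right_real[OF y(1)]
    proof eventually_elim
      case (elim z)
      then have "ereal z < \<omega>"
        using y by (auto intro: less_trans[of _ "ereal y"])
      with elim 1 show ?case
        using eq[of z] mono(1)[of x z] by simp
    qed
    ultimately have "F x \<le> 0"
      by (rule tendsto_lowerbound) simp
    moreover have "G x \<le> 0"
      using mono(2)[OF 1] G0 by simp
    ultimately show ?thesis
      using distribution_function_nonneg[OF F, of x] distribution_function_nonneg[OF G, of x] by simp
  next
    case 3
    then obtain w where w: "\<omega> = ereal w" "0 < w" "w \<le> x"
      using \<omega> by (cases \<omega>) (auto simp: zero_ereal_def)
    have "(G \<longlongrightarrow> 1) (at_left w)"
      using cont[of w] G1[of w] w by (simp add: isCont_def filterlim_at_split)
    moreover have "\<forall>\<^sub>F z in at_left w. G z \<le> F x"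
      using eventually_at_left_real[OF w(2)]
    proof eventually_elim
      case (elim z)
      with w show ?case
        using eq[of z] mono(1)[of z x] by simp
    qed
    ultimately have "1 \<le> F x"
      by (rule tendsto_upperbound) simp
    then show ?thesis
      using distribution_function_le_1[OF F, of x] G1[OF 3(2)] by simp
  qed (use eq in simp)
qed

section \<open>Inversion of a single beta factor\<close>

lemma weyl_inversion:
  assumes M: "real_distribution M" and pos: "AE r in M. 0 < r"
    and ab: "0 < a" "0 < b" "b < 1" and x: "0 < x"
    and G: "G = cdf (mult_conv M (beta_measure a b))"
  shows "weyl_exists (1 - b) (\<lambda>y. pow_fun (- a - 1) y * G y) x"
    and "weyl_stieltjes_exists (1 - b) (pow_fun (- a)) G x"
    and "cdf M x = Gamma a / Gamma (a + b) * x powr (a + b) *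
      (a * weyl (1 - b) (\<lambda>y. pow_fun (- a - 1) y * G y) x - weyl_stieltjes (1 - b) (pow_fun (- a)) G x)"
proof -
  let ?N = "mult_conv M (beta_measure a b)"
  interpret M: real_distribution M by fact
  interpret N: real_distribution ?N
    by (intro real_distribution_mult_conv M real_distribution_beta_measure ab)
  define K where "K = x powr (- a - b) * Beta (a + b) (1 - b)"
  have K: "0 \<le> K"
    using ab Beta_real_pos[of "a + b" "1 - b"] by (simp add: K_def)
  define V where "V = (\<integral>\<^sup>+r. ennreal ((x / r) powr a) * indicator {x<..} r \<partial>M)"
  \<comment> \<open>A bound for \<open>V\<close> makes it a real number \<open>v\<close>, so that
    the two integrals can be subtracted.\<close>
  have "V \<le> (\<integral>\<^sup>+r. 1 \<partial>M)"
    unfolding V_def using x ab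
    by (intro nn_integral_mono) (auto simp: indicator_def intro!: powr_le1)
  then have "V \<le> 1"
    using M.emeasure_space_1 by simp
  then obtain v where v: "0 \<le> v" "V = ennreal v"
    by (cases V) (auto simp: top_unique)
  have meas [measurable]: "G \<in> borel_measurable borel"
    unfolding G by (intro borel_measurable_mono monoI N.cdf_nondecreasing)
  have G_nonneg: "0 \<le> G y" for y
    unfolding G by (rule N.cdf_nonneg)

  \<comment> \<open>A nonnegative integrand with finite integral yields integrability and the value
    at once, hence both the existence predicate and the formula.\<close>
  have "has_bochner_integral lborel (\<lambda>y. indicator {x<..} y * ((y - x) powr - b * (y powr (- a - 1) * G y)))
    (K * (cdf M x + v))"
  proof (rule has_bochner_integral_nn_integral)
    have "(\<integral>\<^sup>+y. ennreal (indicator {x<..} y * ((y - x) powr - b * (y powr (- a - 1) * G y))) \<partial>lborel) =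
      (\<integral>\<^sup>+y. ennreal ((y - x) powr - b * y powr (- a - 1)) * emeasure ?N {..y} * indicator {x<..} y \<partial>lborel)"
      unfolding N.emeasure_eq_measure cdf_def2[symmetric] G[symmetric]
      by (intro nn_integral_cong) (auto simp: indicator_def ennreal_mult[symmetric] G_nonneg mult_ac)
    also have "\<dots> = ennreal (K * (cdf M x + v))"
      unfolding weyl_integral_beta[OF M pos ab x] V_def[symmetric] K_def[symmetric] v(2)
        M.emeasure_eq_measure cdf_def2[symmetric]
      using K v(1) M.cdf_nonneg by (simp add: ennreal_mult)
    finally show "(\<integral>\<^sup>+y. ennreal (indicator {x<..} y * ((y - x) powr - b * (y powr (- a - 1) * G y))) \<partial>lborel) =
      ennreal (K * (cdf M x + v))" .
  qed (use K v(1) M.cdf_nonneg G_nonneg in auto)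
  then have I: "weyl_exists (1 - b) (\<lambda>y. pow_fun (- a - 1) y * G y) x"
    and W: "weyl (1 - b) (\<lambda>y. pow_fun (- a - 1) y * G y) x = 1 / Gamma (1 - b) * (K * (cdf M x + v))"
    by (auto simp: weyl_exists_def weyl_def set_integrable_def set_lebesgue_integral_def pow_fun_def
        has_bochner_integral_iff)

  have "has_bochner_integral ?N (\<lambda>y. indicator {x<..} y * ((y - x) powr - b * y powr - a)) (K * (a * v))"
  proof (rule has_bochner_integral_nn_integral)
    have "(\<integral>\<^sup>+y. ennreal (indicator {x<..} y * ((y - x) powr - b * y powr - a)) \<partial>?N) =
      (\<integral>\<^sup>+y. ennreal ((y - x) powr - b * y powr - a) * indicator {x<..} y \<partial>?N)"
      by (intro nn_integral_cong) (auto simp: indicator_def)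
    also have "\<dots> = ennreal (K * (a * v))"
      unfolding weyl_stieltjes_integral_beta[OF M pos ab x] V_def[symmetric] K_def[symmetric] v(2)
      using K v(1) ab by (simp add: ennreal_mult)
    finally show "(\<integral>\<^sup>+y. ennreal (indicator {x<..} y * ((y - x) powr - b * y powr - a)) \<partial>?N) =
      ennreal (K * (a * v))" .
  qed (use K v(1) ab in auto)
  then have J: "weyl_stieltjes_exists (1 - b) (pow_fun (- a)) G x"
    and S: "weyl_stieltjes (1 - b) (pow_fun (- a)) G x = 1 / Gamma (1 - b) * (K * (a * v))"
    unfolding G
    by (auto simp: weyl_stieltjes_exists_def weyl_stieltjes_def set_integrable_def set_lebesgue_integral_def
        pow_fun_def has_bochner_integral_iff N.interval_measure_cdf)

  show "weyl_exists (1 - b) (\<lambda>y. pow_fun (- a - 1) y * G y) x" by (rule I)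
  show "weyl_stieltjes_exists (1 - b) (pow_fun (- a)) G x" by (rule J)
  have nz: "Gamma a \<noteq> 0" "Gamma (a + b) \<noteq> 0" "Gamma (1 - b) \<noteq> 0"
    using ab Gamma_real_pos[of a] Gamma_real_pos[of "a + b"] Gamma_real_pos[of "1 - b"] by linarith+
  have "Gamma (a + 1) = a * Gamma a"
    using ab by (auto intro!: Gamma_plus1)
  moreover have "x powr (a + b) * x powr (- a - b) = 1"
    using x unfolding powr_add[symmetric] by simp
  \<comment> \<open>The prefactor is the inverse of \<open>a * K / Gamma (1 - b)\<close>, because
    the denominator of \<open>Beta (a + b) (1 - b)\<close> is \<open>Gamma (a + 1)\<close>, that is,
    \<open>a * Gamma a\<close>.\<close>
  ultimately have "Gamma a / Gamma (a + b) * x powr (a + b) * (a * (1 / Gamma (1 - b) * K)) = 1"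
    using ab nz by (simp add: K_def Beta_def field_simps)
  \<comment> \<open>Used with \<open>p = cdf M x\<close> and \<open>g = 1 / Gamma (1 - b)\<close>:
    the contribution of \<open>v\<close> cancels in the difference.\<close>
  moreover have "c * (a * (g * (K * (p + v))) - g * (K * (a * v))) = c * (a * (g * K)) * p" for c g p
    by (simp add: algebra_simps)
  ultimately show "cdf M x = Gamma a / Gamma (a + b) * x powr (a + b) *
      (a * weyl (1 - b) (\<lambda>y. pow_fun (- a - 1) y * G y) x - weyl_stieltjes (1 - b) (pow_fun (- a)) G x)"
    unfolding W S by (simp only: mult_1)
qed

section \<open>Existence, uniqueness and densities of the iterates\<close>

text \<open>That the iterates are determined is rendered as uniqueness on the indices 0 to k + 1.
  Existence of both integrals is part of \<open>iterates\<close>, so that the formula cannot hold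
  merely through the default value 0.\<close>

theorem theorem3p2:
  fixes M :: "'a measure" and R B :: "'a \<Rightarrow> real"
    and H H\<alpha>\<beta> :: "real \<Rightarrow> real" and \<alpha> \<beta> :: real and \<omega> :: ereal
    and k :: nat and b \<delta> :: "nat \<Rightarrow> real"
  assumes "prob_space M"
    and "0 < \<alpha>" and "0 < \<beta>"
    and "R \<in> borel_measurable M" and "AE z in M. 0 < R z"
    and "H = cdf (distr M borel R)"
    and "H 0 = 0" and "lower_endpoint H = 0"
    and "upper_endpoint H = \<omega>" and "0 < \<omega>"
    and "distributed M lborel B (\<lambda>x. ennreal (beta_density \<alpha> \<beta> x))"
    and "prob_space.indep_var M borel R borel B"
    and "H\<alpha>\<beta> = cdf (distr M borel (\<lambda>z. R z * B z))"
    and "b 0 = \<beta>" and "b (k + 1) = 0"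
    and "\<forall>i\<in>{1..k+1}. b i < b (i - 1)"
    and "\<forall>i\<in>{1..k+1}. b (i - 1) - b i \<in> {0<..<1}"
    and "\<forall>i\<in>{1..k+1}. \<delta> i = 1 + b i - b (i - 1)"
  shows
    "let iterates = (\<lambda>Hs :: nat \<Rightarrow> real \<Rightarrow> real.
           Hs 0 = H \<and> Hs (k + 1) = H\<alpha>\<beta> \<and>
           (\<forall>i\<in>{0..k+1}. distribution_function (Hs i)) \<and>
           (\<forall>i\<in>{1..k+1}. \<forall>x. 0 < x \<and> ereal x < \<omega> \<longrightarrow>
              weyl_exists (\<delta> i) (\<lambda>y. pow_fun (- \<alpha> - b i - 1) y * Hs i y) x \<and>
              weyl_stieltjes_exists (\<delta> i) (pow_fun (- \<alpha> - b i)) (Hs i) x \<and>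
              Hs (i - 1) x =
                Gamma (\<alpha> + b i) / Gamma (\<alpha> + b (i - 1)) * x powr (\<alpha> + b (i - 1)) *
                ((\<alpha> + b i) * weyl (\<delta> i) (\<lambda>y. pow_fun (- \<alpha> - b i - 1) y * Hs i y) x
                 - weyl_stieltjes (\<delta> i) (pow_fun (- \<alpha> - b i)) (Hs i) x)))
     in \<exists>Hs. iterates Hs \<and>
             (\<forall>Gs. iterates Gs \<longrightarrow> (\<forall>i\<in>{0..k+1}. Gs i = Hs i)) \<and>
             (\<forall>i\<in>{1..k+1}. \<exists>h. density_of_df (Hs i) h)"
proof -
  define iterates where "iterates = (\<lambda>Hs :: nat \<Rightarrow> real \<Rightarrow> real.
           Hs 0 = H \<and> Hs (k + 1) = H\<alpha>\<beta> \<and>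
           (\<forall>i\<in>{0..k+1}. distribution_function (Hs i)) \<and>
           (\<forall>i\<in>{1..k+1}. \<forall>x. 0 < x \<and> ereal x < \<omega> \<longrightarrow>
              weyl_exists (\<delta> i) (\<lambda>y. pow_fun (- \<alpha> - b i - 1) y * Hs i y) x \<and>
              weyl_stieltjes_exists (\<delta> i) (pow_fun (- \<alpha> - b i)) (Hs i) x \<and>
              Hs (i - 1) x =
                Gamma (\<alpha> + b i) / Gamma (\<alpha> + b (i - 1)) * x powr (\<alpha> + b (i - 1)) *
                ((\<alpha> + b i) * weyl (\<delta> i) (\<lambda>y. pow_fun (- \<alpha> - b i - 1) y * Hs i y) x
                 - weyl_stieltjes (\<delta> i) (pow_fun (- \<alpha> - b i)) (Hs i) x)))"
  interpret prob_space M by fact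
  note [measurable] = \<open>R \<in> borel_measurable M\<close>
  have b_step: "b (Suc i) < b i" "b i - b (Suc i) < 1" if "i \<le> k" for i
    using assms(16,17) that by (auto dest!: bspec[of _ _ "Suc i"])
  have b_mono: "b j \<le> b i" if "i \<le> j" "j \<le> k + 1" for i j
    using that
  proof (induction j rule: dec_induct)
    case (step n)
    then show ?case using b_step(1)[of n] by simp
  qed simp
  have b_nonneg: "0 \<le> b i" if "i \<le> k + 1" for i
    using b_mono[OF that] \<open>b (k + 1) = 0\<close> by simp
  have b_less: "b i < \<beta>" if "1 \<le> i" "i \<le> k + 1" for i
    using b_mono[OF that] b_step(1)[of 0] \<open>b 0 = \<beta>\<close> by simp

  define \<mu> where "\<mu> = distr M borel R"
  have \<mu>: "real_distribution \<mu>"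
    unfolding \<mu>_def by simp
  have \<mu>_pos: "AE r in \<mu>. 0 < r"
    unfolding \<mu>_def using assms(5) by (subst AE_distr_iff) auto
  have H: "H = cdf \<mu>"
    unfolding \<mu>_def by fact
  interpret \<mu>: real_distribution \<mu> by fact
  \<comment> \<open>Index 0 is separate: there the second parameter would be 0, and
    \<open>beta_density\<close> with parameter 0 does not describe the unit mass at 1.\<close>
  define N where "N i = (if i = 0 then \<mu> else mult_conv \<mu> (beta_measure (\<alpha> + b i) (\<beta> - b i)))" for i
  define Hs where "Hs i = cdf (N i)" for i
  have beta: "real_distribution (beta_measure (\<alpha> + b i) (\<beta> - b i))" if "1 \<le> i" "i \<le> k + 1" for i
    using b_nonneg[of i] b_less[of i] that \<open>0 < \<alpha>\<close> by (intro real_distribution_beta_measure) auto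
  have N: "real_distribution (N i)" if "i \<le> k + 1" for i
    using beta[of i] that \<mu> by (auto simp: N_def intro!: real_distribution_mult_conv)
  have N_pos: "AE r in N i. 0 < r" if "i \<le> k + 1" for i
  proof (cases "i = 0")
    case False
    have "AE z in mult_conv \<mu> (beta_measure (\<alpha> + b i) (\<beta> - b i)). 0 < z"
    proof (rule AE_mult_conv)
      show "AE x in \<mu>. AE y in beta_measure (\<alpha> + b i) (\<beta> - b i). 0 < x * y"
        using \<mu>_pos
      proof eventually_elim
        case (elim x)
        from AE_beta_measure show ?case
          by (rule eventually_mono) (use elim in auto)
      qed
    qed (use beta[of i] \<mu> False that in auto)
    moreover have "N i = mult_conv \<mu> (beta_measure (\<alpha> + b i) (\<beta> - b i))"
      using False by (simp add: N_def)
    ultimately show ?thesis by (simp only:)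
  next
    case True
    then have "N i = \<mu>" by (simp add: N_def)
    with \<mu>_pos show ?thesis by (simp only:)
  qed

  have N_step: "N i = mult_conv (N (i - 1)) (beta_measure (\<alpha> + b i) (b (i - 1) - b i))"
    if i: "i \<in> {1..k+1}" for i
  proof (cases "i = 1")
    case True
    then show ?thesis using \<open>b 0 = \<beta>\<close> by (simp add: N_def)
  next
    case False
    with i have j: "1 \<le> i - 1" "i - 1 \<le> k + 1" by auto
    \<comment> \<open>These are the three parameters for \<open>mult_conv_beta_beta\<close>: the
      first two add up to \<open>\<alpha> + b (i - 1)\<close>, the last two to
      \<open>\<beta> - b i\<close>.\<close>
    have pos: "0 < \<alpha> + b i" "0 < b (i - 1) - b i" "0 < \<beta> - b (i - 1)"
      using b_nonneg[of i] b_step(1)[of "i - 1"] b_less[OF j] i \<open>0 < \<alpha>\<close> by auto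
    let ?B = "beta_measure (\<alpha> + b i) (b (i - 1) - b i)"
    have B: "real_distribution ?B"
      using pos by (intro real_distribution_beta_measure)
    have "mult_conv (N (i - 1)) ?B =
        mult_conv \<mu> (mult_conv (beta_measure (\<alpha> + b (i - 1)) (\<beta> - b (i - 1))) ?B)"
      using False i mult_conv_assoc[OF \<mu> beta[OF j] B] by (auto simp: N_def)
    also have "mult_conv (beta_measure (\<alpha> + b (i - 1)) (\<beta> - b (i - 1))) ?B = beta_measure (\<alpha> + b i) (\<beta> - b i)"
      using mult_conv_beta_beta[OF pos] by simp
    finally show ?thesis
      using i by (simp add: N_def)
  qed

  have Hs_0: "Hs 0 = H"
    by (simp add: Hs_def N_def H)
  have Hs_last: "Hs (k + 1) = H\<alpha>\<beta>"
  proof -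
    have B [measurable]: "B \<in> borel_measurable M"
      using distributed_measurable[OF assms(11)] by simp
    have "distr M borel B = distr M lborel B"
      by (rule distr_cong) simp_all
    also have "\<dots> = beta_measure \<alpha> \<beta>"
      unfolding beta_measure_def by (rule distributed_distr_eq_density[OF assms(11)])
    \<comment> \<open>Independence enters here: the joint law of \<open>R\<close> and
      \<open>B\<close> is the product of their laws.\<close>
    finally have "mult_conv \<mu> (beta_measure \<alpha> \<beta>) = distr (distr M (borel \<Otimes>\<^sub>M borel) (\<lambda>z. (R z, B z))) borel (\<lambda>(x, y). x * y)"
      using assms(12) by (simp add: indep_var_distribution_eq mult_conv_def \<mu>_def)
    also have "\<dots> = distr M borel (\<lambda>z. R z * B z)"
      by (subst distr_distr) (auto simp: comp_def)
    finally show ?thesis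
      using \<open>b (k + 1) = 0\<close> assms(13) by (simp add: Hs_def N_def)
  qed
  have Hs_df: "distribution_function (Hs i)" if "i \<le> k + 1" for i
    unfolding Hs_def using N[OF that] by (rule real_distribution.distribution_function_cdf)

  have inversion: "weyl_exists (\<delta> i) (\<lambda>y. pow_fun (- \<alpha> - b i - 1) y * Hs i y) x \<and>
              weyl_stieltjes_exists (\<delta> i) (pow_fun (- \<alpha> - b i)) (Hs i) x \<and>
              Hs (i - 1) x =
                Gamma (\<alpha> + b i) / Gamma (\<alpha> + b (i - 1)) * x powr (\<alpha> + b (i - 1)) *
                ((\<alpha> + b i) * weyl (\<delta> i) (\<lambda>y. pow_fun (- \<alpha> - b i - 1) y * Hs i y) x
                 - weyl_stieltjes (\<delta> i) (pow_fun (- \<alpha> - b i)) (Hs i) x)"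
    if i: "i \<in> {1..k+1}" and x: "0 < x" for i x
  proof -
    \<comment> \<open>Matches \<open>weyl_inversion\<close> with first parameter
      \<open>\<alpha> + b i\<close> and second parameter \<open>b (i - 1) - b i\<close>.\<close>
    have eqs: "\<delta> i = 1 - (b (i - 1) - b i)" "\<alpha> + b (i - 1) = (\<alpha> + b i) + (b (i - 1) - b i)"
        "- \<alpha> - b i = - (\<alpha> + b i)"
      using assms(18) i by auto
    have "i - 1 \<le> k + 1" "0 < \<alpha> + b i" "0 < b (i - 1) - b i" "b (i - 1) - b i < 1"
      using b_nonneg[of i] b_step[of "i - 1"] i \<open>0 < \<alpha>\<close> by auto
    then show ?thesis
      unfolding eqs
      using weyl_inversion[OF N[of "i - 1"] N_pos[of "i - 1"] _ _ _ x, of "\<alpha> + b i" "b (i - 1) - b i" "Hs i"] N_step[OF i]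
      by (simp only: Hs_def)
  qed

  have density: "\<exists>h. density_of_df (Hs i) h" if i: "i \<in> {1..k+1}" for i
  proof -
    interpret Ni: real_distribution "N i" using N[of i] i by simp
    have "0 < \<alpha> + b i" "0 < \<beta> - b i"
      using b_nonneg[of i] b_less[of i] i \<open>0 < \<alpha>\<close> by auto
    then show ?thesis
      using mult_conv_beta_has_density[OF \<mu> \<mu>_pos, of "\<alpha> + b i" "\<beta> - b i"] i
      unfolding density_of_df_def Hs_def Ni.interval_measure_cdf by (simp add: N_def)
  qed

  \<comment> \<open>A law with a density has no atoms.\<close>
  have cont: "isCont (Hs i) x" if i: "i \<in> {1..k+1}" for i x
  proof -
    interpret Ni: real_distribution "N i" using N[of i] i by simp
    obtain h where h: "h \<in> borel_measurable borel" "N i = density lborel (\<lambda>x. ennreal (h x))"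
      using density[OF i] by (auto simp: density_of_df_def Hs_def Ni.interval_measure_cdf)
    have "emeasure (N i) {x} = (\<integral>\<^sup>+y. ennreal (h y) * indicator {x} y \<partial>lborel)"
      using h by (simp add: emeasure_density)
    also have "\<dots> = (\<integral>\<^sup>+(y::real). 0 \<partial>lborel)"
      by (intro nn_integral_cong_AE eventually_mono[OF AE_lborel_singleton[of x]]) auto
    finally have "measure (N i) {x} = 0"
      by (simp add: measure_def)
    then show ?thesis
      by (simp add: Hs_def Ni.isCont_cdf)
  qed
  have zero: "Hs i 0 = 0" if "i \<le> k + 1" for i
  proof -
    interpret Ni: real_distribution "N i" using N[OF that] .
    have "emeasure (N i) {..0} = 0"
      using N_pos[OF that] by (subst AE_iff_measurable[symmetric, where P = "\<lambda>r. 0 < r"]) auto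
    then show ?thesis
      by (simp add: Hs_def cdf_def2 measure_def)
  qed
  \<comment> \<open>Multiplication by a factor in (0, 1) cannot push a positive variable beyond
    \<omega>.\<close>
  have one: "Hs i x = 1" if i: "i \<in> {1..k+1}" and x: "\<omega> \<le> ereal x" for i x
  proof -
    interpret Ni: real_distribution "N i" using N[of i] i by simp
    have "H x = 1"
      using x assms(9) Hs_0 Hs_df[of 0] by (intro distribution_function_eq_1) auto
    then have "AE r in \<mu>. r \<in> {..x}"
      by (subst \<mu>.prob_eq_1[symmetric]) (auto simp: H cdf_def2)
    with \<mu>_pos have "AE r in \<mu>. AE u in beta_measure (\<alpha> + b i) (\<beta> - b i). r * u \<in> {..x}"
    proof eventually_elim
      case (elim r)
      from AE_beta_measure show ?case
      proof eventually_elim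
        case u: (elim u)
        then have "r * u \<le> r"
          using elim by (simp add: mult_left_le)
        moreover have "r \<le> x"
          using elim by simp
        ultimately show ?case
          unfolding atMost_iff by (rule order_trans)
      qed
    qed
    then have "AE z in mult_conv \<mu> (beta_measure (\<alpha> + b i) (\<beta> - b i)). z \<in> {..x}"
      using beta[of i] i by (intro AE_mult_conv \<mu>) auto
    moreover have "N i = mult_conv \<mu> (beta_measure (\<alpha> + b i) (\<beta> - b i))"
      using i by (simp add: N_def)
    ultimately have "AE z in N i. z \<in> {..x}"
      by (simp only:)
    then show ?thesis
      by (subst (asm) Ni.prob_eq_1[symmetric]) (auto simp: Hs_def cdf_def2)
  qed

  have "iterates Hs"
    unfolding iterates_def using Hs_0 Hs_last Hs_df inversion
    by (intro conjI ballI allI impI) (simp_all only: atLeastAtMost_iff)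
  moreover have unique: "Gs i = Hs i" if Gs: "iterates Gs" and i: "i \<le> k + 1" for Gs i
    using i
  proof (induction i rule: inc_induct)
    case base
    show ?case using Gs Hs_last by (simp add: iterates_def)
  next
    case (step n)
    show ?case
    proof (cases "n = 0")
      case True
      then show ?thesis using Gs Hs_0 by (simp add: iterates_def)
    next
      case False
      have n: "Suc n \<in> {1..k+1}" "n \<in> {1..k+1}"
        using step.hyps False by auto
      show ?thesis
      proof (rule distribution_function_eqI[of _ _ \<omega>])
        show "distribution_function (Gs n)"
          using Gs n by (simp add: iterates_def)
        fix x assume x: "0 < x" "ereal x < \<omega>"
        have "\<forall>i\<in>{1..k+1}. \<forall>x. 0 < x \<and> ereal x < \<omega> \<longrightarrow> Gs (i - 1) x =
                Gamma (\<alpha> + b i) / Gamma (\<alpha> + b (i - 1)) * x powr (\<alpha> + b (i - 1)) *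
                ((\<alpha> + b i) * weyl (\<delta> i) (\<lambda>y. pow_fun (- \<alpha> - b i - 1) y * Gs i y) x
                 - weyl_stieltjes (\<delta> i) (pow_fun (- \<alpha> - b i)) (Gs i) x)"
          using Gs unfolding iterates_def by blast
        \<comment> \<open>The formula at index \<open>Suc n\<close> expresses \<open>Gs n\<close>
          through \<open>Gs (Suc n)\<close>, which is \<open>Hs (Suc n)\<close> by induction;
          \<open>inversion\<close> gives the same expression for \<open>Hs n\<close>.\<close>
        from bspec[OF this n(1)] x inversion[OF n(1) x(1)] show "Gs n x = Hs n x"
          unfolding step.IH by simp
      qed (use n Hs_df cont zero one \<open>0 < \<omega>\<close> in auto)
    qed
  qed
  ultimately have "\<exists>Hs. iterates Hs \<and> (\<forall>Gs. iterates Gs \<longrightarrow> (\<forall>i\<in>{0..k+1}. Gs i = Hs i)) \<and>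
      (\<forall>i\<in>{1..k+1}. \<exists>h. density_of_df (Hs i) h)"
  proof (intro exI[of _ Hs] conjI allI impI ballI)
    fix Gs i assume "iterates Gs" "i \<in> {0..k+1}"
    then show "Gs i = Hs i"
      by (intro unique) simp_all
  qed (use density in blast)+
  then show ?thesis
    unfolding iterates_def Let_def .
qed

end
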